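(* Let $p\in(0,1)$, $q=1-p$, $L>0$, $\alpha=q/4$ and $d_F=\frac{\log(4/q)}{\log 2}$. For $x>0$ let $$g(x)=\prod_{j=1}^{\infty}\frac{1}{1+\alpha^{j}x},\qquad f(x)=\sum_{k=1}^{\infty}\frac{L}{2^{k}}\,g(\alpha^{k}x).$$ Then $f(\lambda)\to L$ as $\lambda\to0$, and $f(\lambda)$ is of order $\lambda^{-1/d_F}$ as $\lambda\to\infty$, i.e. $f(\lambda)=\Theta(\lambda^{-1/d_F})$.
   Context: Here $f(\lambda)=\Theta(\lambda^{-1/d_F})$ as $\lambda\to\infty$ means that there are constants $0<c\le C$ and $\lambda_0>0$ with $c\,\lambda^{-1/d_F}\le f(\lambda)\le C\,\lambda^{-1/d_F}$ for all $\lambda\ge\lambda_0$. In the hyperfractal Manhattan parking model, $f(\lambda Lp/(2\alpha))$ is the expected distance driven to the first free slot under the jumpless strategy, where $\lambda$ is the total pop-up intensity. *)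

theory Defs
  imports "HOL-Analysis.Analysis"
begin

text \<open>The product over \<open>j \<ge> 1\<close> and the sum over \<open>k \<ge> 1\<close> are shifted to start at 0.  Both functions
  are meant for \<open>x > 0\<close> only.\<close>

definition hyperfractal_g :: "real \<Rightarrow> real \<Rightarrow> real" where
  "hyperfractal_g \<alpha> x = (\<Prod>j. 1 / (1 + \<alpha> ^ Suc j * x))"

definition hyperfractal_f :: "real \<Rightarrow> real \<Rightarrow> real \<Rightarrow> real" where
  "hyperfractal_f L \<alpha> x = (\<Sum>k. L / 2 ^ Suc k * hyperfractal_g \<alpha> (\<alpha> ^ Suc k * x))"

end

theory Submission
  imports Defs
begin

text \<open>
  The sum is self-similar: splitting off its first term gives
  \<open>f x = (L * g (\<alpha> * x) + f (\<alpha> * x)) / 2\<close> (\<open>hyperfractal_f_rescale\<close>).  Put \<open>s = 1 / d_F\<close>, so that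
  \<open>\<alpha> powr s = 1 / 2\<close>.  Then \<open>x powr - s\<close> solves the homogeneous equation \<open>h x = h (\<alpha> * x) / 2\<close>, and
  the term with \<open>g\<close> is a perturbation of order \<open>1 / x\<close>, because \<open>g\<close> is bounded by the first factor
  of its product.  That perturbation is of lower order than \<open>x powr - s\<close> because \<open>\<alpha> < 1 / 2\<close>, which
  amounts to \<open>s < 1\<close>.

  Both power bounds, the upper one sharpened by a term of order \<open>1 / x\<close>, therefore hold everywhere
  on \<open>{\<alpha>..}\<close> as soon as they hold on the fundamental domain \<open>{\<alpha>..1}\<close> of the scaling
  \<open>x \<mapsto> \<alpha> * x\<close> (\<open>scaling_induct\<close>).  On that domain, and likewise for the limit at \<open>0\<close>,
  it is enough to know \<open>L * exp (- x) \<le> f x \<le> L\<close> (\<open>hyperfractal_f_bounds\<close>).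
\<close>

section \<open>Induction along a geometric scale\<close>

lemma scaling_induct:
  fixes \<alpha> b x :: real
  assumes \<alpha>: "0 < \<alpha>" "\<alpha> < 1" and b: "0 < b" and x: "\<alpha> * b \<le> x"
    and base: "\<And>x. \<alpha> * b \<le> x \<Longrightarrow> x \<le> b \<Longrightarrow> P x"
    and step: "\<And>x. b < x \<Longrightarrow> P (\<alpha> * x) \<Longrightarrow> P x"
  shows "P x"
proof -
  have "0 < x"
    using \<alpha> b x by (meson less_le_trans mult_pos_pos)
  then obtain n where "\<alpha> ^ n < b / x"
    using real_arch_pow_inv[of "b / x" \<alpha>] \<alpha> b by auto
  then have "\<alpha> ^ n * x \<le> b"
    using \<open>0 < x\<close> by (simp add: field_simps)
  then show ?thesis
    using x
  proof (induction n arbitrary: x)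
    case 0
    then show ?case using base by simp
  next
    case (Suc n)
    show ?case
    proof (cases "x \<le> b")
      case True
      then show ?thesis using base Suc.prems by blast
    next
      case False
      then have "P (\<alpha> * x)"
        using Suc \<alpha> by (simp add: mult_ac)
      then show ?thesis using step False by simp
    qed
  qed
qed

section \<open>Bounds for the infinite product\<close>

text \<open>The partial products lie between \<open>exp\<close> of minus the geometric sum of the \<open>\<alpha> ^ j * x\<close>, by
  \<open>1 + a \<le> exp a\<close>, and their first factor, since all further factors are at most \<open>1\<close>.  For
  \<open>\<alpha> \<le> 1 / 2\<close> the geometric sum is at most \<open>x\<close>.\<close>

lemma hyperfractal_g_bounds:
  assumes \<alpha>: "0 < \<alpha>" "\<alpha> \<le> 1 / 2" and x: "0 < x"
  shows "exp (- x) \<le> hyperfractal_g \<alpha> x" and "hyperfractal_g \<alpha> x \<le> 1 / (1 + \<alpha> * x)"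
proof -
  define a where "a j = \<alpha> ^ Suc j * x" for j
  have a_pos: "0 < a j" for j
    using \<alpha> x by (simp add: a_def)
  have a_sums: "a sums (\<alpha> * x / (1 - \<alpha>))"
    using sums_mult[OF geometric_sums[of \<alpha>], of "\<alpha> * x"] \<alpha> by (simp add: a_def [abs_def] mult_ac)
  have sum_le: "sum a A \<le> x" if "finite A" for A
  proof -
    have "sum a A \<le> \<alpha> * x / (1 - \<alpha>)"
      using sum_le_suminf[OF sums_summable[OF a_sums] that] a_pos sums_unique[OF a_sums]
      by (simp add: less_imp_le)
    also have "\<dots> \<le> x"
      using \<alpha> x by (simp add: field_simps)
    finally show ?thesis .
  qed
  have "convergent_prod (\<lambda>j. 1 + a j)"
    using convergent_prod_iff_summable_real[of a] a_pos sums_summable[OF a_sums] by blast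
  then have "convergent_prod (\<lambda>j. 1 / (1 + a j))"
    using convergent_prod_inverse[of "\<lambda>j. 1 + a j"] by (simp add: inverse_eq_divide)
  then have lim: "(\<lambda>n. \<Prod>j\<le>n. 1 / (1 + a j)) \<longlonglongrightarrow> hyperfractal_g \<alpha> x"
    using convergent_prod_LIMSEQ[of "\<lambda>j. 1 / (1 + a j)"] by (simp add: hyperfractal_g_def a_def)
  have "exp (- x) \<le> (\<Prod>j\<le>n. 1 / (1 + a j))" for n
  proof -
    have "(\<Prod>j\<le>n. 1 + a j) \<le> exp (sum a {..n})"
      using a_pos by (intro prod_le_exp_sum) (simp add: less_imp_le)
    also have "\<dots> \<le> exp x"
      using sum_le by simp
    finally have "(\<Prod>j\<le>n. 1 + a j) \<le> exp x" .
    moreover have "0 < (\<Prod>j\<le>n. 1 + a j)"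
      using a_pos by (intro prod_pos) (simp add: add_pos_pos)
    ultimately show ?thesis
      by (simp add: prod_dividef exp_minus field_simps)
  qed
  then show "exp (- x) \<le> hyperfractal_g \<alpha> x"
    by (intro LIMSEQ_le_const[OF lim]) auto
  have "(\<Prod>j\<le>n. 1 / (1 + a j)) \<le> 1 / (1 + \<alpha> * x)" for n
  proof -
    have "(\<Prod>j\<in>{..n} - {0}. 1 / (1 + a j)) \<le> 1"
      using a_pos by (intro prod_le_1) (simp add: less_imp_le add_pos_pos)
    then have "1 / (1 + a 0) * (\<Prod>j\<in>{..n} - {0}. 1 / (1 + a j)) \<le> 1 / (1 + a 0)"
      using a_pos[of 0] by (intro mult_left_le) auto
    then show ?thesis
      by (simp add: prod.remove[of "{..n}" 0] a_def)
  qed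
  then show "hyperfractal_g \<alpha> x \<le> 1 / (1 + \<alpha> * x)"
    by (intro LIMSEQ_le_const2[OF lim]) auto
qed

corollary hyperfractal_g_le_1:
  assumes "0 < \<alpha>" "\<alpha> \<le> 1 / 2" "0 < x"
  shows "hyperfractal_g \<alpha> x \<le> 1"
proof -
  have "1 / (1 + \<alpha> * x) \<le> 1"
    using mult_pos_pos[OF assms(1,3)] by simp
  then show ?thesis
    using hyperfractal_g_bounds(2)[OF assms] by linarith
qed

section \<open>The weighted series and its functional equation\<close>

lemma hyperfractal_f_summable:
  assumes \<alpha>: "0 < \<alpha>" "\<alpha> \<le> 1 / 2" and x: "0 < x" and L: "0 \<le> L"
  shows "summable (\<lambda>k. L / 2 ^ Suc k * hyperfractal_g \<alpha> (\<alpha> ^ Suc k * x))"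
proof (rule summable_comparison_test')
  show "summable (\<lambda>k. L * (1 / 2) ^ Suc k)"
    using sums_summable[OF sums_mult[OF power_half_series]] .
  show "norm (L / 2 ^ Suc k * hyperfractal_g \<alpha> (\<alpha> ^ Suc k * x)) \<le> L * (1 / 2) ^ Suc k" for k
  proof -
    let ?g = "hyperfractal_g \<alpha> (\<alpha> ^ Suc k * x)"
    have y: "0 < \<alpha> ^ Suc k * x"
      using \<alpha> x by simp
    have "0 \<le> ?g"
      using hyperfractal_g_bounds(1)[OF \<alpha> y] order_trans[OF exp_ge_zero] by blast
    moreover have "?g \<le> 1"
      using hyperfractal_g_le_1[OF \<alpha> y] .
    moreover have "0 \<le> L / 2 ^ Suc k"
      using L by simp
    ultimately have "norm (L / 2 ^ Suc k * ?g) \<le> L / 2 ^ Suc k"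
      using mult_left_le[of ?g "L / 2 ^ Suc k"] by (simp only: real_norm_def abs_of_nonneg mult_nonneg_nonneg)
    then show ?thesis
      by (simp add: power_one_over divide_simps)
  qed
qed

text \<open>The weights \<open>L / 2 ^ k\<close> add up to \<open>L\<close>, so bounds on \<open>g\<close> that are uniform over the arguments
  \<open>\<alpha> ^ k * x \<le> x\<close> carry over to \<open>f\<close>.\<close>

lemma hyperfractal_f_bounds:
  assumes \<alpha>: "0 < \<alpha>" "\<alpha> \<le> 1 / 2" and x: "0 < x" and L: "0 \<le> L"
  shows "L * exp (- x) \<le> hyperfractal_f L \<alpha> x" and "hyperfractal_f L \<alpha> x \<le> L"
proof -
  have weights: "(\<lambda>k. L / 2 ^ Suc k * c) sums (L * c)" for c :: real
    using sums_mult[OF power_half_series, of "L * c"] by (simp add: power_one_over mult_ac)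
  have f_sums: "(\<lambda>k. L / 2 ^ Suc k * hyperfractal_g \<alpha> (\<alpha> ^ Suc k * x)) sums hyperfractal_f L \<alpha> x"
    using summable_sums[OF hyperfractal_f_summable[OF assms]] by (simp add: hyperfractal_f_def)
  have y: "0 < \<alpha> ^ Suc k * x" for k
    using \<alpha> x by simp
  have yx: "\<alpha> ^ Suc k * x \<le> x" for k
    using \<alpha> x mult_left_le_one_le[of x "\<alpha> ^ Suc k"] power_le_one[of \<alpha> "Suc k"] by simp
  have "exp (- x) \<le> hyperfractal_g \<alpha> (\<alpha> ^ Suc k * x)" for k
    using yx hyperfractal_g_bounds(1)[OF \<alpha> y[of k]] by (meson exp_le_cancel_iff neg_le_iff_le order_trans)
  then show "L * exp (- x) \<le> hyperfractal_f L \<alpha> x"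
    using L by (intro sums_le[OF _ weights f_sums] mult_left_mono) auto
  have "hyperfractal_g \<alpha> (\<alpha> ^ Suc k * x) \<le> 1" for k
    using hyperfractal_g_le_1[OF \<alpha> y] .
  then have "hyperfractal_f L \<alpha> x \<le> L * 1"
    using L by (intro sums_le[OF _ f_sums weights] mult_left_mono) auto
  then show "hyperfractal_f L \<alpha> x \<le> L"
    by simp
qed

lemma hyperfractal_f_rescale:
  assumes \<alpha>: "0 < \<alpha>" "\<alpha> \<le> 1 / 2" and x: "0 < x" and L: "0 \<le> L"
  shows "hyperfractal_f L \<alpha> x = (L * hyperfractal_g \<alpha> (\<alpha> * x) + hyperfractal_f L \<alpha> (\<alpha> * x)) / 2"
proof -
  let ?t = "\<lambda>x k. L / 2 ^ Suc k * hyperfractal_g \<alpha> (\<alpha> ^ Suc k * x)"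
  have "hyperfractal_f L \<alpha> x = ?t x 0 + (\<Sum>k. ?t x (Suc k))"
    using suminf_split_head[OF hyperfractal_f_summable[OF assms]] by (simp add: hyperfractal_f_def)
  also have "(\<lambda>k. ?t x (Suc k)) = (\<lambda>k. ?t (\<alpha> * x) k / 2)"
    by (simp add: fun_eq_iff mult_ac)
  also have "suminf \<dots> = hyperfractal_f L \<alpha> (\<alpha> * x) / 2"
    using hyperfractal_f_summable[of \<alpha> "\<alpha> * x" L] assms
    unfolding hyperfractal_f_def by (intro suminf_divide) simp
  finally show ?thesis
    by (simp add: add_divide_distrib)
qed

lemma hyperfractal_f_tendsto_at_right_0:
  assumes \<alpha>: "0 < \<alpha>" "\<alpha> \<le> 1 / 2" and L: "0 \<le> L"
  shows "(hyperfractal_f L \<alpha> \<longlongrightarrow> L) (at_right 0)"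
proof (rule tendsto_sandwich)
  have pos: "\<forall>\<^sub>F x :: real in at_right 0. 0 < x"
    by (simp add: eventually_at_right_less)
  show "\<forall>\<^sub>F x in at_right 0. L * exp (- x) \<le> hyperfractal_f L \<alpha> x"
    using pos by eventually_elim (rule hyperfractal_f_bounds(1)[OF \<alpha> _ L])
  show "\<forall>\<^sub>F x in at_right 0. hyperfractal_f L \<alpha> x \<le> L"
    using pos by eventually_elim (rule hyperfractal_f_bounds(2)[OF \<alpha> _ L])
  show "((\<lambda>x. L * exp (- x)) \<longlongrightarrow> L) (at_right 0)"
    by (auto intro!: tendsto_eq_intros)
qed auto

section \<open>Power law at infinity\<close>

lemma powr_minus_rescale:
  fixes \<alpha> s x :: real
  assumes "0 < \<alpha>" "0 < x" "\<alpha> powr s = 1 / 2"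
  shows "(\<alpha> * x) powr - s = 2 * x powr - s"
  using assms by (simp only: powr_mult powr_minus less_imp_le) (simp add: field_simps)

text \<open>Dropping the nonnegative term with \<open>g\<close> turns the functional equation into
  \<open>f x \<ge> f (\<alpha> * x) / 2\<close>, which transports the bound from one scale to the next.  The constant is
  fixed by the fundamental domain, where \<open>x powr - s \<le> \<alpha> powr - s = 2\<close> and \<open>f x \<ge> L * exp (- 1)\<close>.\<close>

lemma hyperfractal_f_power_lower_bound:
  assumes \<alpha>: "0 < \<alpha>" "\<alpha> \<le> 1 / 2" and L: "0 \<le> L"
    and s: "0 \<le> s" "\<alpha> powr s = 1 / 2" and x: "\<alpha> \<le> x"
  shows "L * exp (- 1) / 2 * x powr - s \<le> hyperfractal_f L \<alpha> x"
proof (rule scaling_induct[where P = "\<lambda>x. L * exp (- 1) / 2 * x powr - s \<le> hyperfractal_f L \<alpha> x"])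
  show "0 < \<alpha>" "\<alpha> < 1" "(0 :: real) < 1" "\<alpha> * 1 \<le> x"
    using \<alpha> x by auto
next
  fix x :: real
  assume x: "\<alpha> * 1 \<le> x" "x \<le> 1"
  have "x powr - s \<le> \<alpha> powr - s"
    using \<alpha> x s by (intro powr_mono2') auto
  then have "x powr - s \<le> 2"
    using s by (simp add: powr_minus)
  then have "L * exp (- 1) / 2 * x powr - s \<le> L * exp (- 1) / 2 * 2"
    using L by (intro mult_left_mono) auto
  also have "\<dots> \<le> L * exp (- x)"
    using L x by (simp add: mult_left_mono)
  also have "\<dots> \<le> hyperfractal_f L \<alpha> x"
    using \<alpha> L x by (intro hyperfractal_f_bounds) auto
  finally show "L * exp (- 1) / 2 * x powr - s \<le> hyperfractal_f L \<alpha> x" .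
next
  fix x :: real
  assume x: "1 < x"
    and IH: "L * exp (- 1) / 2 * (\<alpha> * x) powr - s \<le> hyperfractal_f L \<alpha> (\<alpha> * x)"
  have "0 \<le> hyperfractal_g \<alpha> (\<alpha> * x)"
    using hyperfractal_g_bounds(1)[OF \<alpha>, of "\<alpha> * x"] \<alpha> x order_trans[OF exp_ge_zero] by auto
  then have "0 \<le> L * hyperfractal_g \<alpha> (\<alpha> * x)"
    using L by simp
  then have "hyperfractal_f L \<alpha> (\<alpha> * x) / 2 \<le> hyperfractal_f L \<alpha> x"
    using hyperfractal_f_rescale[OF \<alpha> _ L, of x] x by simp
  moreover have "L * exp (- 1) / 2 * x powr - s = L * exp (- 1) / 2 * (\<alpha> * x) powr - s / 2"
    using powr_minus_rescale[OF \<alpha>(1) _ s(2), of x] x by simp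
  ultimately show "L * exp (- 1) / 2 * x powr - s \<le> hyperfractal_f L \<alpha> x"
    using IH by linarith
qed

text \<open>A bound by \<open>C * x powr - s\<close> alone does not propagate, since the term with \<open>g\<close> adds an error at
  each scale.  Subtracting \<open>D / x\<close> repairs this: halving the correction at \<open>\<alpha> * x\<close> gives
  \<open>D / (2 * \<alpha> * x)\<close>, which exceeds \<open>D / x\<close> as \<open>\<alpha> < 1 / 2\<close>, and the surplus pays for the error.\<close>

lemma hyperfractal_f_power_upper_bound:
  assumes \<alpha>: "0 < \<alpha>" "\<alpha> < 1 / 2" and L: "0 \<le> L"
    and s: "0 \<le> s" "\<alpha> powr s = 1 / 2" and x: "\<alpha> \<le> x"
  defines "D \<equiv> L / (\<alpha> * (1 - 2 * \<alpha>))"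
  shows "hyperfractal_f L \<alpha> x \<le> (L + D / \<alpha>) * x powr - s - D / x"
proof (rule scaling_induct[where
    P = "\<lambda>x. hyperfractal_f L \<alpha> x \<le> (L + D / \<alpha>) * x powr - s - D / x"])
  show "0 < \<alpha>" "\<alpha> < 1" "(0 :: real) < 1" "\<alpha> * 1 \<le> x"
    using \<alpha> x by auto
next
  have D: "0 \<le> D"
    using \<alpha> L by (simp add: D_def)
  fix x :: real
  assume x: "\<alpha> * 1 \<le> x" "x \<le> 1"
  have "1 \<le> x powr - s"
    using powr_mono2'[of "- s" x 1] \<alpha> x s by simp
  then have "(L + D / \<alpha>) * 1 \<le> (L + D / \<alpha>) * x powr - s"
    using \<alpha> L D by (intro mult_left_mono) auto
  moreover have "D / x \<le> D / \<alpha>"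
    using \<alpha> x D by (intro divide_left_mono) auto
  ultimately have "(L + D / \<alpha>) * 1 - D / \<alpha> \<le> (L + D / \<alpha>) * x powr - s - D / x"
    by (rule diff_mono)
  moreover have "hyperfractal_f L \<alpha> x \<le> L"
    using \<alpha> L x by (intro hyperfractal_f_bounds) auto
  ultimately show "hyperfractal_f L \<alpha> x \<le> (L + D / \<alpha>) * x powr - s - D / x"
    by simp
next
  fix x :: real
  assume x: "1 < x"
    and IH: "hyperfractal_f L \<alpha> (\<alpha> * x) \<le> (L + D / \<alpha>) * (\<alpha> * x) powr - s - D / (\<alpha> * x)"
  have \<alpha>': "\<alpha> \<le> 1 / 2"
    using \<alpha> by simp
  have "hyperfractal_g \<alpha> (\<alpha> * x) \<le> 1 / (1 + \<alpha> * (\<alpha> * x))"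
    using \<alpha> x by (intro hyperfractal_g_bounds) auto
  also have "\<dots> \<le> 1 / (\<alpha> * (\<alpha> * x))"
    using \<alpha> x by (intro divide_left_mono) (auto intro!: mult_pos_pos add_pos_pos)
  finally have "L * hyperfractal_g \<alpha> (\<alpha> * x) \<le> L * (1 / (\<alpha> * (\<alpha> * x)))"
    using L by (intro mult_left_mono)
  (* The value of D is the solution of this balance between error and surplus. *)
  also have "\<dots> = D / (\<alpha> * x) - 2 * (D / x)"
    using \<alpha> x by (simp add: D_def divide_simps) (simp add: algebra_simps)
  finally have "L * hyperfractal_g \<alpha> (\<alpha> * x) \<le> D / (\<alpha> * x) - 2 * (D / x)" .
  moreover have "(L + D / \<alpha>) * (\<alpha> * x) powr - s = 2 * ((L + D / \<alpha>) * x powr - s)"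
    using powr_minus_rescale[OF \<alpha>(1) _ s(2), of x] x by simp
  moreover have "2 * hyperfractal_f L \<alpha> x = L * hyperfractal_g \<alpha> (\<alpha> * x) + hyperfractal_f L \<alpha> (\<alpha> * x)"
    using hyperfractal_f_rescale[OF \<alpha>(1) \<alpha>' _ L, of x] x by simp
  ultimately show "hyperfractal_f L \<alpha> x \<le> (L + D / \<alpha>) * x powr - s - D / x"
    using IH by linarith
qed

theorem theorem4p2:
  fixes p q L \<alpha> d_F :: real
  assumes "0 < p" and "p < 1"
    and "q = 1 - p"
    and "0 < L"
    and "\<alpha> = q / 4"
    and "d_F = ln (4 / q) / ln 2"
  shows "(hyperfractal_f L \<alpha> \<longlongrightarrow> L) (at_right 0) \<and>
         (\<exists>c C x0. 0 < c \<and> c \<le> C \<and> 0 < x0 \<and>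
            (\<forall>x\<ge>x0. c * x powr (- 1 / d_F) \<le> hyperfractal_f L \<alpha> x \<and>
                     hyperfractal_f L \<alpha> x \<le> C * x powr (- 1 / d_F)))"
proof -
  have \<alpha>: "0 < \<alpha>" "\<alpha> < 1 / 2" "\<alpha> \<le> 1 / 2"
    using assms by auto
  have L: "0 \<le> L"
    using assms by simp
  define s where "s = 1 / d_F"
  have "4 / q = inverse \<alpha>"
    unfolding assms(5) by simp
  then have d_F: "d_F = - ln \<alpha> / ln 2"
    using assms(6) \<alpha> by (simp add: ln_inverse)
  have "ln \<alpha> < 0"
    using \<alpha> by simp
  moreover from d_F have "s = ln 2 / - ln \<alpha>"
    by (simp add: s_def)
  ultimately have s: "0 \<le> s" and "s * ln \<alpha> = - ln 2"
    by (simp_all add: divide_nonneg_neg)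
  then have \<alpha>_powr: "\<alpha> powr s = 1 / 2"
    using \<alpha> by (simp add: powr_def exp_minus)
  define c where "c = L * exp (- 1) / 2"
  define D where "D = L / (\<alpha> * (1 - 2 * \<alpha>))"
  define C where "C = L + D / \<alpha>"
  have D: "0 \<le> D"
    using \<alpha> L by (simp add: D_def)
  have bounds: "c * x powr - s \<le> hyperfractal_f L \<alpha> x \<and> hyperfractal_f L \<alpha> x \<le> C * x powr - s"
    if "\<alpha> \<le> x" for x
  proof
    show "c * x powr - s \<le> hyperfractal_f L \<alpha> x"
      unfolding c_def by (rule hyperfractal_f_power_lower_bound[OF \<alpha>(1,3) L s \<alpha>_powr that])
    have "hyperfractal_f L \<alpha> x \<le> C * x powr - s - D / x"
      unfolding C_def D_def by (rule hyperfractal_f_power_upper_bound[OF \<alpha>(1,2) L s \<alpha>_powr that])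
    moreover have "0 \<le> D / x"
      using D \<alpha> that by simp
    ultimately show "hyperfractal_f L \<alpha> x \<le> C * x powr - s"
      by linarith
  qed
  have "0 < c"
    using assms by (simp add: c_def)
  moreover have "c \<le> C"
    using bounds[of 1] \<alpha> by simp
  ultimately have "\<exists>c C x0. 0 < c \<and> c \<le> C \<and> 0 < x0 \<and>
      (\<forall>x\<ge>x0. c * x powr - s \<le> hyperfractal_f L \<alpha> x \<and> hyperfractal_f L \<alpha> x \<le> C * x powr - s)"
    using bounds \<alpha>(1) by blast
  then show ?thesis
    using hyperfractal_f_tendsto_at_right_0[OF \<alpha>(1,3) L] by (simp add: s_def)
qed

end
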